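(* For every negative even integer $k$ and every positive integer $n$, $a(n,k)=c^{-k}_{\text{odd}}(n)$.
   Context: For an integer $k$, $A(n,k)$ is the set of compositions $(c_1,\ldots,c_t)$ of $n$ (finite sequences of positive integers summing to $n$) such that $c_{2i-1}>c_{2i}+k$ for every $i$ with $2i\le t$ (no condition on the last part if $t$ is odd), and $a(n,k)=|A(n,k)|$. For a nonnegative integer $j$, $C^{2j}_{\text{odd}}(n)$ is the set of compositions of $n$ whose parts all lie in the set of positive odd integers together with the even integers $2,4,\ldots,2j$, and $c^{2j}_{\text{odd}}(n)=|C^{2j}_{\text{odd}}(n)|$. *)

theory Defs
  imports Main
begin

definition compositions :: "nat \<Rightarrow> nat list set" where
  "compositions n = {c. (\<forall>p\<in>set c. p > 0) \<and> sum_list c = n}"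

lemma finite_compositions: "finite (compositions n)"
proof (rule finite_subset)
  have "length c \<le> sum_list c" if "\<forall>p\<in>set c. p > 0" for c :: "nat list"
    using that by (induction c) auto
  then show "compositions n \<subseteq> {c. set c \<subseteq> {..n} \<and> length c \<le> n}"
    by (auto simp: compositions_def member_le_sum_list)
  show "finite {c. set c \<subseteq> {..n} \<and> length c \<le> n}"
    by (simp add: finite_lists_length_le)
qed

text \<open>Lists are indexed from 0, so the 1-based parts \<open>c\<^sub>2\<^sub>i\<^sub>-\<^sub>1\<close> and \<open>c\<^sub>2\<^sub>i\<close> are
  \<open>c ! (2 * i - 2)\<close> and \<open>c ! (2 * i - 1)\<close>. The inequality is taken over the integers,
  since \<open>k\<close> may be negative.\<close>

definition A :: "nat \<Rightarrow> int \<Rightarrow> nat list set" where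
  "A n k = {c \<in> compositions n.
     \<forall>i\<ge>1. 2 * i \<le> length c \<longrightarrow> int (c ! (2 * i - 2)) > int (c ! (2 * i - 1)) + k}"

definition a :: "nat \<Rightarrow> int \<Rightarrow> nat" where
  "a n k = card (A n k)"

text \<open>The first argument \<open>m\<close> is the superscript \<open>2j\<close> itself (not \<open>j\<close>); only even \<open>m\<close> is
  of interest.\<close>

definition C_odd :: "nat \<Rightarrow> nat \<Rightarrow> nat list set" where
  "C_odd m n = {c \<in> compositions n. set c \<subseteq> {p. odd p} \<union> {p. even p \<and> 2 \<le> p \<and> p \<le> m}}"

definition c_odd :: "nat \<Rightarrow> nat \<Rightarrow> nat" where
  "c_odd m n = card (C_odd m n)"

end

theory Submission
  imports Defs "HOL-Computational_Algebra.Formal_Power_Series"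
begin

text \<open>
  Put \<open>m = -k\<close> and count by generating functions. Let \<open>P\<close> enumerate the pairs of positive
  integers \<open>x\<close>, \<open>y\<close> with \<open>y < x + m\<close> by their sum, and let \<open>O\<close> enumerate the allowed parts on the
  other side. Splitting off the first pair, respectively the first part, gives the generating
  functions \<open>1 / ((1 - q) (1 - P))\<close> and \<open>1 / (1 - O)\<close>. Since \<open>(1 - q) (1 - q^2) P = q^2 + q^3 - q^(m+2)\<close>
  and, for even \<open>m\<close>, \<open>(1 - q^2) O = q + q^2 - q^(m+2)\<close>, both are equal to
  \<open>(1 - q^2) / (1 - q - 2 q^2 + q^(m+2))\<close>.
\<close>

section \<open>Generating functions of sets of words, graded by the sum of the letters\<close>

definition words_of_sum :: "nat list set \<Rightarrow> nat \<Rightarrow> nat list set" where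
  "words_of_sum L n = {c \<in> L. sum_list c = n}"

definition gf :: "nat list set \<Rightarrow> int fps" where
  "gf L = Abs_fps (\<lambda>n. int (card (words_of_sum L n)))"

text \<open>Positive letters leave only finitely many words of each sum, so \<open>card\<close> in
  \<open>gf\<close> is a genuine count. An infinite set would have \<open>card\<close> 0, and the
  sum and product rules could fail.\<close>

definition positive_words :: "nat list set" where
  "positive_words = {c. \<forall>p\<in>set c. p > 0}"

lemma gf_nth: "fps_nth (gf L) n = int (card (words_of_sum L n))"
  by (simp add: gf_def)

lemma finite_words_of_sum: "L \<subseteq> positive_words \<Longrightarrow> finite (words_of_sum L n)"
  by (rule finite_subset[OF _ finite_compositions[of n]])
    (auto simp: words_of_sum_def positive_words_def compositions_def)

lemma concat_subset_positive_words:
  "L \<subseteq> positive_words \<Longrightarrow> M \<subseteq> positive_words \<Longrightarrow>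
    (\<lambda>(u, v). u @ v) ` (L \<times> M) \<subseteq> positive_words"
  by (fastforce simp: positive_words_def)

lemma gf_Un:
  assumes "L \<subseteq> positive_words" "M \<subseteq> positive_words" "L \<inter> M = {}"
  shows "gf (L \<union> M) = gf L + gf M"
proof (rule fps_ext)
  fix n
  have "words_of_sum (L \<union> M) n = words_of_sum L n \<union> words_of_sum M n"
       "words_of_sum L n \<inter> words_of_sum M n = {}"
    using assms(3) by (auto simp: words_of_sum_def)
  then show "fps_nth (gf (L \<union> M)) n = fps_nth (gf L + gf M) n"
    using assms by (simp add: gf_nth card_Un_disjoint finite_words_of_sum)
qed

text \<open>Sums add under concatenation, so sorting the pairs by the sum of the first factor gives
  the Cauchy product. Injectivity says that factorizations are unique.\<close>

lemma gf_concat: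
  assumes "L \<subseteq> positive_words" "M \<subseteq> positive_words"
    and inj: "inj_on (\<lambda>(u, v). u @ v) (L \<times> M)"
  shows "gf ((\<lambda>(u, v). u @ v) ` (L \<times> M)) = gf L * gf M"
proof (rule fps_ext)
  fix n
  let ?f = "\<lambda>(u, v). u @ v"
  let ?B = "\<lambda>i. words_of_sum L i \<times> words_of_sum M (n - i)"
  have sub: "(\<Union>i\<in>{0..n}. ?B i) \<subseteq> L \<times> M"
    by (auto simp: words_of_sum_def)
  have "(\<Union>i\<in>{0..n}. ?B i) = {(u, v). u \<in> L \<and> v \<in> M \<and> sum_list u + sum_list v = n}"
    by (auto simp: words_of_sum_def)
  then have "words_of_sum (?f ` (L \<times> M)) n = ?f ` (\<Union>i\<in>{0..n}. ?B i)"
    by (auto simp: words_of_sum_def)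
  then have "card (words_of_sum (?f ` (L \<times> M)) n) = card (\<Union>i\<in>{0..n}. ?B i)"
    by (simp only: card_image[OF inj_on_subset[OF inj sub]])
  also have "\<dots> = (\<Sum>i=0..n. card (?B i))"
    by (rule card_UN_disjoint)
      (use assms in \<open>auto simp: finite_words_of_sum, auto simp: words_of_sum_def\<close>)
  finally show "fps_nth (gf (?f ` (L \<times> M))) n = fps_nth (gf L * gf M) n"
    by (simp add: gf_nth fps_mult_nth card_cartesian_product)
qed

lemma gf_Nil: "gf {[]} = 1"
proof (rule fps_ext)
  fix n
  have "words_of_sum {[]} n = (if n = 0 then {[]} else {})"
    by (auto simp: words_of_sum_def)
  then show "fps_nth (gf {[]}) n = fps_nth 1 n"
    by (simp add: gf_nth)
qed

lemma gf_letters_nth: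
  "fps_nth (gf ((\<lambda>p. [p]) ` S)) n = (if n \<in> S then 1 else 0)"
proof -
  have "words_of_sum ((\<lambda>p. [p]) ` S) n = (if n \<in> S then {[n]} else {})"
    by (auto simp: words_of_sum_def)
  then show ?thesis
    by (simp add: gf_nth)
qed

section \<open>Words over an alphabet\<close>

definition words_over :: "nat set \<Rightarrow> nat list set" where
  "words_over S = {c. set c \<subseteq> S}"

lemma words_over_eq:
  "words_over S = {[]} \<union> (\<lambda>(u, v). u @ v) ` ((\<lambda>p. [p]) ` S \<times> words_over S)"
proof (intro set_eqI)
  fix c
  show "c \<in> words_over S \<longleftrightarrow> c \<in> {[]} \<union> (\<lambda>(u, v). u @ v) ` ((\<lambda>p. [p]) ` S \<times> words_over S)"
    by (cases c) (auto simp: words_over_def image_iff)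
qed

text \<open>Splitting off the first letter gives W = 1 + S W. The product form avoids inverses of
  integer power series.\<close>

lemma gf_words_over:
  assumes "0 \<notin> S"
  shows "gf (words_over S) * (1 - gf ((\<lambda>p. [p]) ` S)) = 1"
proof -
  let ?f = "\<lambda>(u, v). u @ v" and ?S = "(\<lambda>p. [p]) ` S"
  have pos: "?S \<subseteq> positive_words" "words_over S \<subseteq> positive_words"
    using assms by (auto simp: positive_words_def words_over_def intro: gr0I)
  then have img: "?f ` (?S \<times> words_over S) \<subseteq> positive_words"
    by (rule concat_subset_positive_words)
  have "gf (words_over S) = gf ({[]} \<union> ?f ` (?S \<times> words_over S))"
    by (subst words_over_eq) (rule refl)
  also have "\<dots> = gf {[]} + gf (?f ` (?S \<times> words_over S))"
    by (rule gf_Un) (use img in \<open>auto simp: positive_words_def\<close>)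
  also have "\<dots> = 1 + gf ?S * gf (words_over S)"
    using pos by (subst gf_concat) (auto simp: gf_Nil inj_on_def)
  finally show ?thesis
    by (simp add: algebra_simps)
qed

section \<open>Words with a gap condition on disjoint adjacent pairs\<close>

definition gap_pairs :: "int \<Rightarrow> nat list set" where
  "gap_pairs k = {[x, y] | x y. x > 0 \<and> y > 0 \<and> int x > int y + k}"

definition gap_words :: "int \<Rightarrow> nat list set" where
  "gap_words k = {c \<in> positive_words.
     \<forall>i\<ge>1. 2 * i \<le> length c \<longrightarrow> int (c ! (2 * i - 2)) > int (c ! (2 * i - 1)) + k}"

lemma gap_words_short: "[] \<in> gap_words k" "[x] \<in> gap_words k \<longleftrightarrow> x > 0"
  by (auto simp: gap_words_def positive_words_def)

lemma gap_words_Cons_Cons: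
  "x # y # c \<in> gap_words k \<longleftrightarrow> [x, y] \<in> gap_pairs k \<and> c \<in> gap_words k"
proof -
  define G where "G c i \<longleftrightarrow> (2 * i \<le> length c \<longrightarrow>
    int (c ! (2 * i - 2)) > int (c ! (2 * i - 1)) + k)" for c :: "nat list" and i
  \<comment> \<open>Starting at \<open>Suc i\<close> avoids index 0, where the truncated
    subtractions would compare \<open>c ! 0\<close> with itself.\<close>
  have shift: "G (x # y # c) (Suc (Suc i)) = G c (Suc i)" for i
    by (simp add: G_def)
  have ge_1: "(\<forall>i\<ge>1. Q i) \<longleftrightarrow> (\<forall>i. Q (Suc i))" for Q :: "nat \<Rightarrow> bool"
    by (metis One_nat_def Suc_le_D Suc_le_mono le0)
  have "(\<forall>i\<ge>1. G (x # y # c) i) \<longleftrightarrow> (\<forall>i. G (x # y # c) (Suc i))"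
    by (rule ge_1)
  also have "\<dots> \<longleftrightarrow> G (x # y # c) 1 \<and> (\<forall>i. G c (Suc i))"
    by (metis One_nat_def shift not0_implies_Suc)
  also have "\<dots> \<longleftrightarrow> int x > int y + k \<and> (\<forall>i\<ge>1. G c i)"
    unfolding ge_1 by (simp add: G_def)
  finally show ?thesis
    unfolding gap_words_def gap_pairs_def positive_words_def G_def by auto
qed

lemma gap_words_eq:
  "gap_words k = ({[]} \<union> (\<lambda>p. [p]) ` {0<..}) \<union>
     (\<lambda>(u, v). u @ v) ` (gap_pairs k \<times> gap_words k)"
proof (intro set_eqI)
  fix c
  show "c \<in> gap_words k \<longleftrightarrow> c \<in> ({[]} \<union> (\<lambda>p. [p]) ` {0<..}) \<union>
     (\<lambda>(u, v). u @ v) ` (gap_pairs k \<times> gap_words k)"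
  \<comment> \<open>This rule serves only to split lists into length 0, length 1 and length at least
    2.\<close>
  proof (cases c rule: remdups_adj.cases)
    case (3 x y d)
    have "c \<in> (\<lambda>(u, v). u @ v) ` (gap_pairs k \<times> gap_words k) \<longleftrightarrow>
        [x, y] \<in> gap_pairs k \<and> d \<in> gap_words k"
    proof
      assume "[x, y] \<in> gap_pairs k \<and> d \<in> gap_words k"
      then show "c \<in> (\<lambda>(u, v). u @ v) ` (gap_pairs k \<times> gap_words k)"
        using 3 by (intro image_eqI[of _ _ "([x, y], d)"]) auto
    qed (use 3 in \<open>auto simp: gap_pairs_def\<close>)
    with 3 show ?thesis
      by (simp add: gap_words_Cons_Cons image_iff)
  qed (auto simp: gap_words_short gap_pairs_def)
qed

text \<open>The words without a complete pair contribute 1 + q + q^2 + ... = 1 / (1 - q). Every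
  other word has a unique first pair, because all words in \<open>gap_pairs k\<close> have length
  2.\<close>

lemma gf_gap_words: "(1 - fps_X) * (gf (gap_words k) * (1 - gf (gap_pairs k))) = 1"
proof -
  let ?f = "\<lambda>(u, v). u @ v" and ?S = "(\<lambda>p. [p]) ` {0::nat<..}"
  have pos: "gap_pairs k \<subseteq> positive_words" "gap_words k \<subseteq> positive_words" "?S \<subseteq> positive_words"
      "{[]} \<subseteq> positive_words"
    by (auto simp: positive_words_def gap_words_def gap_pairs_def)
  have img: "?f ` (gap_pairs k \<times> gap_words k) \<subseteq> positive_words"
    using pos(1,2) by (rule concat_subset_positive_words)
  have "gf (gap_words k) = gf (({[]} \<union> ?S) \<union> ?f ` (gap_pairs k \<times> gap_words k))"
    by (subst gap_words_eq) (rule refl)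
  also have "\<dots> = gf ({[]} \<union> ?S) + gf (?f ` (gap_pairs k \<times> gap_words k))"
    by (rule gf_Un) (use img pos in \<open>auto simp: gap_pairs_def\<close>)
  also have "gf ({[]} \<union> ?S) = 1 + gf ?S"
    using pos by (subst gf_Un) (auto simp: gf_Nil)
  also have "gf (?f ` (gap_pairs k \<times> gap_words k)) = gf (gap_pairs k) * gf (gap_words k)"
    using pos by (subst gf_concat) (auto simp: gap_pairs_def inj_on_def)
  finally have "gf (gap_words k) * (1 - gf (gap_pairs k)) = 1 + gf ?S"
    by (simp add: algebra_simps)
  moreover have "(1 - fps_X) * (1 + gf ?S) = 1"
    by (rule fps_ext) (auto simp: algebra_simps gf_letters_nth)
  ultimately show ?thesis
    by simp
qed

text \<open>Adding 1 to both entries keeps their difference, so it maps the pairs of sum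
  \<open>n\<close> onto those of sum \<open>n + 2\<close> without an entry 1. What remains is
  \<open>[n + 1, 1]\<close>, and \<open>[1, n + 1]\<close> if \<open>n < m\<close>; for
  \<open>n = 0\<close> these coincide.\<close>

lemma card_gap_pairs_step:
  fixes m :: nat
  assumes "m > 0"
  shows "card (words_of_sum (gap_pairs (- int m)) (n + 2)) =
    card (words_of_sum (gap_pairs (- int m)) n) + 1 + (if 0 < n \<and> n < m then 1 else 0)"
proof -
  let ?W = "words_of_sum (gap_pairs (- int m))"
  let ?N = "if 0 < n \<and> n < m then {[1, n + 1]} else {}"
  have fin: "finite (?W n)"
    by (rule finite_words_of_sum) (auto simp: gap_pairs_def positive_words_def)
  have mem: "c \<in> ?W j \<longleftrightarrow> (\<exists>x y. c = [x, y] \<and> x > 0 \<and> y > 0 \<and> y < x + m \<and> x + y = j)" for c j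
    by (auto simp: words_of_sum_def gap_pairs_def)
  have "?W (n + 2) = (map Suc ` ?W n \<union> {[n + 1, 1]}) \<union> ?N"
  proof (intro equalityI subsetI)
    fix c assume "c \<in> ?W (n + 2)"
    then obtain x y where c: "c = [x, y]" "x > 0" "y > 0" "y < x + m" "x + y = n + 2"
      by (auto simp: mem)
    show "c \<in> (map Suc ` ?W n \<union> {[n + 1, 1]}) \<union> ?N"
    proof (cases "x = 1 \<or> y = 1")
      case False
      then have "[x - 1, y - 1] \<in> ?W n" "c = map Suc [x - 1, y - 1]"
        using c by (auto simp: mem)
      then show ?thesis by blast
    qed (use c in auto)
  next
    fix c assume "c \<in> (map Suc ` ?W n \<union> {[n + 1, 1]}) \<union> ?N"
    then show "c \<in> ?W (n + 2)"
      using assms by (auto simp: mem split: if_splits)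
  qed
  moreover have "card ((map Suc ` ?W n \<union> {[n + 1, 1]}) \<union> ?N) =
      card (map Suc ` ?W n \<union> {[n + 1, 1]}) + card ?N"
    by (rule card_Un_disjoint) (use fin in \<open>auto simp: mem\<close>)
  moreover have "card (map Suc ` ?W n \<union> {[n + 1, 1]}) = card (map Suc ` ?W n) + 1"
    by (subst card_Un_disjoint) (use fin in \<open>auto simp: mem\<close>)
  moreover have "card (map Suc ` ?W n) = card (?W n)"
    by (rule card_image) (auto intro: inj_onI)
  ultimately show ?thesis
    by simp
qed

lemma gf_gap_pairs:
  fixes m :: nat
  assumes "m > 0"
  shows "(1 - fps_X) * ((1 - fps_X ^ 2) * gf (gap_pairs (- int m))) =
    fps_X ^ 2 + fps_X ^ 3 - fps_X ^ (m + 2)"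
proof -
  let ?P = "gf (gap_pairs (- int m))"
  have small: "words_of_sum (gap_pairs (- int m)) n = {}" if "n < 2" for n
    using that by (auto simp: words_of_sum_def gap_pairs_def)
  have R: "(1 - fps_X ^ 2) * ?P =
      Abs_fps (\<lambda>n. (if 2 \<le> n then 1 else 0) + (if 2 < n \<and> n < m + 2 then 1 else 0))" (is "_ = ?R")
  proof (rule fps_ext)
    fix n
    show "fps_nth ((1 - fps_X ^ 2) * ?P) n = fps_nth ?R n"
    proof (cases "n < 2")
      case True
      then show ?thesis
        by (simp add: left_diff_distrib fps_X_power_mult_nth gf_nth small)
    next
      case False
      then obtain j where "n = j + 2"
        by (metis add.commute le_Suc_ex not_less)
      then show ?thesis
        using card_gap_pairs_step[OF assms, of j]
        by (simp add: left_diff_distrib fps_X_power_mult_nth gf_nth)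
    qed
  qed
  \<comment> \<open>The coefficients are indicators of an infinite and a finite interval;
    multiplying by 1 - q leaves only their end points.\<close>
  show ?thesis
    unfolding R by (rule fps_ext) (use assms in \<open>auto simp: left_diff_distrib\<close>)
qed

section \<open>The allowed parts: odd numbers and small even numbers\<close>

definition odd_or_small :: "nat \<Rightarrow> nat set" where
  "odd_or_small m = {p. odd p} \<union> {p. even p \<and> 2 \<le> p \<and> p \<le> m}"

text \<open>Membership is unchanged by a shift by 2 except where the odd parts start (1), where the
  even parts start (2), and where they stop (\<open>m + 2\<close>). For \<open>m = 0\<close> the
  last two cancel.\<close>

lemma gf_odd_or_small:
  assumes "even m"
  shows "(1 - fps_X ^ 2) * gf ((\<lambda>p. [p]) ` odd_or_small m) = fps_X + fps_X ^ 2 - fps_X ^ (m + 2)"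
proof (rule fps_ext)
  fix n :: nat
  consider "n = 0" | "n = 1" | j where "n = j + 2"
    by (metis One_nat_def Suc_1 add.commute le_Suc_ex less_2_cases not_less)
  then show "fps_nth ((1 - fps_X ^ 2) * gf ((\<lambda>p. [p]) ` odd_or_small m)) n =
      fps_nth (fps_X + fps_X ^ 2 - fps_X ^ (m + 2)) n"
  proof cases
    case 3
    \<comment> \<open>An even \<open>j\<close> below the even \<open>m\<close> satisfies
      \<open>j + 2 \<le> m\<close>, so for positive such \<open>j\<close> both \<open>j\<close> and
      \<open>j + 2\<close> are allowed.\<close>
    have "j = 0 \<or> j = m \<or> j < m \<and> j + 2 \<le> m \<or> odd j \<or> j > m"
      using assms by (auto elim!: evenE)
    with 3 assms show ?thesis
      by (auto simp: left_diff_distrib fps_X_power_mult_nth gf_letters_nth odd_or_small_def)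
  qed (auto simp: left_diff_distrib fps_X_power_mult_nth gf_letters_nth odd_or_small_def)
qed

theorem theorem4p4:
  fixes k :: int and n :: nat
  assumes "k < 0" and "even k" and "n > 0"
  shows "a n k = c_odd (nat (- k)) n"
proof -
  define m where "m = nat (- k)"
  have m: "m > 0" "even m" and k: "k = - int m"
    using assms by (auto simp: m_def even_nat_iff)
  define FA FC P Q :: "int fps"
    where defs: "FA = gf (gap_words k)" "FC = gf (words_over (odd_or_small m))"
      "P = gf (gap_pairs k)" "Q = gf ((\<lambda>p. [p]) ` odd_or_small m)"
  let ?q = "fps_X :: int fps"
  \<comment> \<open>The common denominator: multiplied by it, both series become
    \<open>1 - ?q ^ 2\<close>.\<close>
  let ?D = "1 - ?q - 2 * ?q ^ 2 + ?q ^ (m + 2)"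
  have FA: "(1 - ?q) * (FA * (1 - P)) = 1"
    unfolding defs by (rule gf_gap_words)
  have P: "(1 - ?q) * ((1 - ?q ^ 2) * P) = ?q ^ 2 + ?q ^ 3 - ?q ^ (m + 2)"
    unfolding defs k by (rule gf_gap_pairs[OF m(1)])
  have FC: "FC * (1 - Q) = 1"
    unfolding defs by (rule gf_words_over) (simp add: odd_or_small_def)
  have Q: "(1 - ?q ^ 2) * Q = ?q + ?q ^ 2 - ?q ^ (m + 2)"
    unfolding defs by (rule gf_odd_or_small[OF m(2)])
  have "?D = (1 - ?q) * (1 - ?q ^ 2) - (1 - ?q) * ((1 - ?q ^ 2) * P)"
    unfolding P by (simp add: algebra_simps power2_eq_square power3_eq_cube)
  then have "FA * ?D = (1 - ?q ^ 2) * ((1 - ?q) * (FA * (1 - P)))"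
    by (simp only:) (simp add: algebra_simps)
  moreover have "?D = (1 - ?q ^ 2) - (1 - ?q ^ 2) * Q"
    unfolding Q by simp
  then have "FC * ?D = (1 - ?q ^ 2) * (FC * (1 - Q))"
    by (simp only:) (simp add: algebra_simps)
  ultimately have "FA * ?D = FC * ?D"
    by (simp only: FA FC)
  \<comment> \<open>The constant term is 1, so \<open>?D\<close> is nonzero and can be cancelled in
    the integral domain \<open>int fps\<close>.\<close>
  moreover have "fps_nth ?D 0 \<noteq> 0"
    by simp
  then have "?D \<noteq> 0"
    by (metis fps_zero_nth)
  ultimately have "fps_nth FA n = fps_nth FC n"
    by (metis mult_right_cancel)
  moreover have "words_of_sum (gap_words k) n = A n k"
    by (auto simp: words_of_sum_def gap_words_def positive_words_def A_def compositions_def)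
  moreover have "words_of_sum (words_over (odd_or_small m)) n = C_odd m n"
    by (auto simp: words_of_sum_def words_over_def odd_or_small_def C_odd_def compositions_def
        intro: gr0I)
  ultimately show ?thesis
    by (simp add: defs gf_nth a_def c_odd_def m_def)
qed

end
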